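(* Let $\mathbf{C}$ be a reversal-closed super-$\mathrm{AFL}$. Let $S_1,S_2$ be $\mathbf{C}$-tabled semigroups. Then the semigroup free product $S_1\ast S_2$ is $\mathbf{C}$-tabled.
   Context: For a word $w=a_1\cdots a_n$ write $w^{\mathrm{rev}}=a_n\cdots a_1$, and for a language $L$ write $L^{\mathrm{rev}}=\{w^{\mathrm{rev}}\mid w\in L\}$. A class $\mathbf{C}$ of languages (over finite alphabets) is reversal-closed if $L\in\mathbf{C}$ implies $L^{\mathrm{rev}}\in\mathbf{C}$. A full $\mathrm{AFL}$ is a class of languages closed under homomorphism, inverse homomorphism, intersection with regular languages, union, concatenation, and Kleene star. A rewriting system over a finite alphabet $A$ is a subset $\mathscr{R}\subseteq A^\ast\times A^\ast$; write $u\to_{\mathscr{R}}v$ if $u=x\ell y$, $v=xry$ for some $x,y\in A^\ast$, $(\ell,r)\in\mathscr{R}$, and let $\to^\ast_{\mathscr{R}}$ be the reflexive transitive closure. It is monadic if every $(u,v)\in\mathscr{R}$ satisfies $|u|\ge|v|$ and $v\in A\cup\{\varepsilon\}$. A monadic system is $\mathbf{C}$-monadic if for every $a\in A\cup\{\varepsilon\}$ the language $\{u\mid(u,a)\in\mathscr{R}\}$ lies in $\mathbf{C}$. For $L\subseteq A^\ast$, the set of ancestors is $\nabla^\ast_{\mathscr{R}}(L)=\{w\in A^\ast\mid \exists x\in L:\ w\to^\ast_{\mathscr{R}}x\}$. $\mathbf{C}$ has the monadic ancestor property if for every finite alphabet $A$, every $\mathbf{C}$-monadic $\mathscr{R}\subseteq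 A^\ast\times A^\ast$ and every $L\subseteq A^\ast$ with $L\in\mathbf{C}$, one has $\nabla^\ast_{\mathscr{R}}(L)\in\mathbf{C}$. A super-$\mathrm{AFL}$ is a full $\mathrm{AFL}$ with the monadic ancestor property. Let $S$ be a semigroup generated by a finite set $A$, with surjective homomorphism $\pi_S\colon A^+\to S$. A regular language $R\subseteq A^+$ is a language of normal forms for $S$ if every element of $S$ is represented (via $\pi_S$) by exactly one word of $R$. With $\#_1,\#_2$ new symbols, $\mathcal{T}_S(R)=\{u\#_1v\#_2w^{\mathrm{rev}}\mid u,v,w\in R,\ \pi_S(u)\pi_S(v)=\pi_S(w)\}$. $S$ is $\mathbf{C}$-tabled if (for some finite generating set $A$) there is a regular language $R\subseteq A^+$ of normal forms for $S$ with $\mathcal{T}_S(R)\in\mathbf{C}$. The semigroup free product is the coproduct in the category of semigroups. *)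

theory Defs
  imports "HOL-Algebra.Group"
begin

section \<open>Languages and language classes\<close>

text \<open>
  All symbols are drawn from one fixed countably infinite supply, the type \<^typ>\<open>nat\<close>; an alphabet is
  a finite set of symbols and \<^term>\<open>lists A\<close> is the free monoid over \<open>A\<close>. A class of languages closed
  under homomorphisms is closed under injective renaming of symbols, hence determined by its
  languages over such alphabets.
\<close>

type_synonym word = "nat list"
type_synonym lang = "nat list set"

definition language_class :: "lang set \<Rightarrow> bool" where
  "language_class C \<longleftrightarrow> (\<forall>L\<in>C. \<exists>A. finite A \<and> L \<subseteq> lists A)"

text \<open>Recognisability by a deterministic finite automaton \<open>(Q, q0, \<delta>, F)\<close> over a finite alphabet.\<close>

definition regular_language :: "lang \<Rightarrow> bool" where
  "regular_language L \<longleftrightarrow>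
     (\<exists>A (Q :: nat set) q0 \<delta> F.
        finite A \<and> finite Q \<and> q0 \<in> Q \<and> F \<subseteq> Q \<and> (\<forall>q\<in>Q. \<forall>a\<in>A. \<delta> q a \<in> Q) \<and>
        L = {w \<in> lists A. foldl \<delta> q0 w \<in> F})"

text \<open>The homomorphism of free monoids determined by the images \<open>h\<close> of the symbols.\<close>

definition word_hom :: "(nat \<Rightarrow> word) \<Rightarrow> word \<Rightarrow> word" where
  "word_hom h w = concat (map h w)"

definition lang_concat :: "lang \<Rightarrow> lang \<Rightarrow> lang" where
  "lang_concat L K = {u @ v | u v. u \<in> L \<and> v \<in> K}"

definition lang_star :: "lang \<Rightarrow> lang" where
  "lang_star L = concat ` lists L"

definition reversal_closed :: "lang set \<Rightarrow> bool" where
  "reversal_closed C \<longleftrightarrow> (\<forall>L\<in>C. rev ` L \<in> C)"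

definition full_AFL :: "lang set \<Rightarrow> bool" where
  "full_AFL C \<longleftrightarrow>
     language_class C \<and>
     (\<forall>L\<in>C. \<forall>h. word_hom h ` L \<in> C) \<and>
     (\<forall>L\<in>C. \<forall>h A. finite A \<longrightarrow> {w \<in> lists A. word_hom h w \<in> L} \<in> C) \<and>
     (\<forall>L\<in>C. \<forall>R. regular_language R \<longrightarrow> L \<inter> R \<in> C) \<and>
     (\<forall>L\<in>C. \<forall>K\<in>C. L \<union> K \<in> C) \<and>
     (\<forall>L\<in>C. \<forall>K\<in>C. lang_concat L K \<in> C) \<and>
     (\<forall>L\<in>C. lang_star L \<in> C)"


section \<open>Rewriting systems and the monadic ancestor property\<close>

definition rewrite_step :: "nat set \<Rightarrow> (word \<times> word) set \<Rightarrow> (word \<times> word) set" where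
  "rewrite_step A R = {(x @ l @ y, x @ r @ y) | x l r y. x \<in> lists A \<and> y \<in> lists A \<and> (l, r) \<in> R}"

definition ancestors :: "nat set \<Rightarrow> (word \<times> word) set \<Rightarrow> lang \<Rightarrow> lang" where
  "ancestors A R L = {w \<in> lists A. \<exists>x\<in>L. (w, x) \<in> (rewrite_step A R)\<^sup>*}"

definition monadic :: "nat set \<Rightarrow> (word \<times> word) set \<Rightarrow> bool" where
  "monadic A R \<longleftrightarrow>
     R \<subseteq> lists A \<times> lists A \<and>
     (\<forall>(u, v)\<in>R. length u \<ge> length v \<and> (v = [] \<or> (\<exists>a\<in>A. v = [a])))"

definition class_monadic :: "lang set \<Rightarrow> nat set \<Rightarrow> (word \<times> word) set \<Rightarrow> bool" where
  "class_monadic C A R \<longleftrightarrow>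
     monadic A R \<and> {u. (u, []) \<in> R} \<in> C \<and> (\<forall>a\<in>A. {u. (u, [a]) \<in> R} \<in> C)"

definition monadic_ancestor_property :: "lang set \<Rightarrow> bool" where
  "monadic_ancestor_property C \<longleftrightarrow>
     (\<forall>A R L. finite A \<longrightarrow> class_monadic C A R \<longrightarrow> L \<subseteq> lists A \<longrightarrow> L \<in> C \<longrightarrow> ancestors A R L \<in> C)"

definition super_AFL :: "lang set \<Rightarrow> bool" where
  "super_AFL C \<longleftrightarrow> full_AFL C \<and> monadic_ancestor_property C"


section \<open>Semigroups\<close>

text \<open>
  Semigroups are carried by the monoid records of HOL-Algebra, whose unit field is ignored. The
  library's \<^const>\<open>hom\<close> and \<^const>\<open>epi\<close> do not mention the unit either, so they are the semigroup
  homomorphisms and surjective semigroup homomorphisms.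
\<close>

locale alg_semigroup =
  fixes S (structure)
  assumes mult_closed: "\<lbrakk>x \<in> carrier S; y \<in> carrier S\<rbrakk> \<Longrightarrow> x \<otimes> y \<in> carrier S"
    and mult_assoc: "\<lbrakk>x \<in> carrier S; y \<in> carrier S; z \<in> carrier S\<rbrakk>
      \<Longrightarrow> (x \<otimes> y) \<otimes> z = x \<otimes> (y \<otimes> z)"

definition free_semigroup :: "nat set \<Rightarrow> word monoid" where
  "free_semigroup A = \<lparr>carrier = lists A - {[]}, mult = (@), one = undefined\<rparr>"

definition normal_forms :: "('a, 'm) monoid_scheme \<Rightarrow> nat set \<Rightarrow> (word \<Rightarrow> 'a) \<Rightarrow> lang \<Rightarrow> bool" where
  "normal_forms S A \<pi> R \<longleftrightarrow>
     regular_language R \<and> R \<subseteq> carrier (free_semigroup A) \<and> (\<forall>s\<in>carrier S. \<exists>!w. w \<in> R \<and> \<pi> w = s)"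

definition mult_table :: "('a, 'm) monoid_scheme \<Rightarrow> (word \<Rightarrow> 'a) \<Rightarrow> nat \<Rightarrow> nat \<Rightarrow> lang \<Rightarrow> lang" where
  "mult_table S \<pi> c d R =
     {u @ [c] @ v @ [d] @ rev w | u v w. u \<in> R \<and> v \<in> R \<and> w \<in> R \<and> \<pi> u \<otimes>\<^bsub>S\<^esub> \<pi> v = \<pi> w}"

definition tabled :: "lang set \<Rightarrow> ('a, 'm) monoid_scheme \<Rightarrow> bool" where
  "tabled C S \<longleftrightarrow>
     (\<exists>A \<pi> R c d.
        finite A \<and> \<pi> \<in> epi (free_semigroup A) S \<and> normal_forms S A \<pi> R \<and>
        c \<notin> A \<and> d \<notin> A \<and> c \<noteq> d \<and> mult_table S \<pi> c d R \<in> C)"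


section \<open>The semigroup free product\<close>

text \<open>
  Elements are the nonempty words over the disjoint union of the two carriers in which letters of
  the two factors alternate. In a product the two letters that meet are multiplied if they come
  from the same factor. The theorems \<open>free_product_universal\<close> and \<open>free_product_inclusions\<close> below
  show that this is the coproduct in the category of semigroups.
\<close>

fun join :: "('a, 'm) monoid_scheme \<Rightarrow> ('b, 'n) monoid_scheme \<Rightarrow> 'a + 'b \<Rightarrow> 'a + 'b \<Rightarrow> ('a + 'b) list"
  where
  "join S T (Inl x) (Inl y) = [Inl (x \<otimes>\<^bsub>S\<^esub> y)]"
| "join S T (Inr x) (Inr y) = [Inr (x \<otimes>\<^bsub>T\<^esub> y)]"
| "join S T a b = [a, b]"

definition free_product ::
  "('a, 'm) monoid_scheme \<Rightarrow> ('b, 'n) monoid_scheme \<Rightarrow> ('a + 'b) list monoid" where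
  "free_product S T =
     \<lparr>carrier = {w \<in> lists (carrier S <+> carrier T). w \<noteq> [] \<and> successively (\<lambda>a b. isl a \<noteq> isl b) w},
      mult = (\<lambda>u v. butlast u @ join S T (last u) (hd v) @ tl v),
      one = undefined\<rparr>"

lemma free_product_semigroup:
  assumes "alg_semigroup S" and "alg_semigroup T"
  shows "alg_semigroup (free_product S T)"
proof -
  interpret S: alg_semigroup S by fact
  interpret T: alg_semigroup T by fact
  let ?X = "carrier S <+> carrier T"
  let ?alt = "successively (\<lambda>a b :: 'a + 'c. isl a \<noteq> isl b)"
  show ?thesis
  proof
    fix u v
    assume u: "u \<in> carrier (free_product S T)" and v: "v \<in> carrier (free_product S T)"
    obtain u' x where ux: "u = u' @ [x]"
      using u by (cases u rule: rev_cases) (auto simp: free_product_def)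
    obtain y v' where vy: "v = y # v'"
      using v by (cases v) (auto simp: free_product_def)
    show "u \<otimes>\<^bsub>free_product S T\<^esub> v \<in> carrier (free_product S T)"
      using u v S.mult_closed T.mult_closed
      by (cases x; cases y)
        (auto simp: ux vy free_product_def successively_append_iff successively_Cons)
  next
    fix u v w
    assume u: "u \<in> carrier (free_product S T)" and v: "v \<in> carrier (free_product S T)"
      and w: "w \<in> carrier (free_product S T)"
    obtain u' x where ux: "u = u' @ [x]" "x \<in> ?X"
      using u by (cases u rule: rev_cases) (auto simp: free_product_def)
    obtain z w' where wz: "w = z # w'" "z \<in> ?X"
      using w by (cases w) (auto simp: free_product_def)
    obtain y v' where vy: "v = y # v'" "y \<in> ?X"
      using v by (cases v) (auto simp: free_product_def)
    show "u \<otimes>\<^bsub>free_product S T\<^esub> v \<otimes>\<^bsub>free_product S T\<^esub> w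
        = u \<otimes>\<^bsub>free_product S T\<^esub> (v \<otimes>\<^bsub>free_product S T\<^esub> w)"
    proof (cases v' rule: rev_cases)
      case Nil
      then show ?thesis
        using ux(2) vy(2) wz(2) S.mult_assoc T.mult_assoc
        by (cases x; cases y; cases z) (auto simp: free_product_def ux(1) vy(1) wz(1) butlast_append)
    next
      case (snoc m y')
      then show ?thesis
        by (cases x; cases y; cases y'; cases z)
          (auto simp: free_product_def ux(1) vy(1) wz(1) butlast_append)
    qed
  qed
qed

lemma free_product_inclusions:
  "(\<lambda>x. [Inl x]) \<in> hom S (free_product S T)"
  "(\<lambda>y. [Inr y]) \<in> hom T (free_product S T)"
  if "alg_semigroup S" and "alg_semigroup T"
  using that by (auto simp: hom_def free_product_def alg_semigroup_def)

fun lift_word :: "('c, 'k) monoid_scheme \<Rightarrow> ('a \<Rightarrow> 'c) \<Rightarrow> ('b \<Rightarrow> 'c) \<Rightarrow> ('a + 'b) list \<Rightarrow> 'c" where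
  "lift_word U f g [] = undefined"
| "lift_word U f g [a] = case_sum f g a"
| "lift_word U f g (a # b # w) = case_sum f g a \<otimes>\<^bsub>U\<^esub> lift_word U f g (b # w)"

lemma lift_word_hom:
  assumes "alg_semigroup S" and "alg_semigroup T" and "alg_semigroup U"
    and f: "f \<in> hom S U" and g: "g \<in> hom T U"
  shows "lift_word U f g \<in> hom (free_product S T) U"
proof -
  interpret S: alg_semigroup S by fact
  interpret T: alg_semigroup T by fact
  interpret U: alg_semigroup U by fact
  let ?X = "carrier S <+> carrier T"
  let ?\<phi> = "case_sum f g" and ?h = "lift_word U f g"
  have \<phi>: "?\<phi> a \<in> carrier U" if "a \<in> ?X" for a
    using that f g by (auto simp: hom_def)
  have lift_Cons: "?h (a # w) = ?\<phi> a \<otimes>\<^bsub>U\<^esub> ?h w" if "w \<noteq> []" for a w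
    using that by (cases w) auto
  have closed: "?h w \<in> carrier U" if "w \<noteq> []" "w \<in> lists ?X" for w
    using that
  proof (induction w rule: list_nonempty_induct)
    case (single a)
    then show ?case using \<phi> by auto
  next
    case (cons a w)
    then show ?case
      using \<phi>[of a] U.mult_closed by (cases w) auto
  qed
  have base: "?h (join S T a b @ w) = ?\<phi> a \<otimes>\<^bsub>U\<^esub> ?h (b # w)"
    if "a \<in> ?X" "b \<in> ?X" "w \<in> lists ?X" for a b w
  proof (cases "isl a = isl b")
    case False
    then show ?thesis by (cases a; cases b) auto
  next
    case True
    then have "\<exists>c. join S T a b = [c] \<and> ?\<phi> c = ?\<phi> a \<otimes>\<^bsub>U\<^esub> ?\<phi> b"
      using that f g by (cases a; cases b) (auto simp: hom_def)
    then obtain c where c: "join S T a b = [c]" "?\<phi> c = ?\<phi> a \<otimes>\<^bsub>U\<^esub> ?\<phi> b"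
      by blast
    show ?thesis
    proof (cases "w = []")
      case True
      then show ?thesis using c by simp
    next
      case False
      then show ?thesis
        using c \<phi> that closed[of w] U.mult_assoc by (simp add: lift_Cons)
    qed
  qed
  have mult: "?h (butlast u @ join S T (last u) b @ v) = ?h u \<otimes>\<^bsub>U\<^esub> ?h (b # v)"
    if "u \<noteq> []" "u \<in> lists ?X" "b \<in> ?X" "v \<in> lists ?X" for u b v
    using that(1,2)
  proof (induction u rule: list_nonempty_induct)
    case (single a)
    then show ?case using base that(3,4) by auto
  next
    case (cons a u)
    have "join S T (last u) b \<noteq> []"
      by (cases "last u"; cases b) auto
    then have "?h (butlast (a # u) @ join S T (last (a # u)) b @ v)
        = ?\<phi> a \<otimes>\<^bsub>U\<^esub> ?h (butlast u @ join S T (last u) b @ v)"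
      using cons.hyps by (simp add: lift_Cons)
    also have "\<dots> = ?\<phi> a \<otimes>\<^bsub>U\<^esub> (?h u \<otimes>\<^bsub>U\<^esub> ?h (b # v))"
      using cons by auto
    also have "\<dots> = ?\<phi> a \<otimes>\<^bsub>U\<^esub> ?h u \<otimes>\<^bsub>U\<^esub> ?h (b # v)"
    proof (rule U.mult_assoc[symmetric])
      show "?\<phi> a \<in> carrier U" using \<phi> cons.prems by simp
      show "?h u \<in> carrier U" using closed cons by simp
      show "?h (b # v) \<in> carrier U" using closed that(3,4) by simp
    qed
    also have "?\<phi> a \<otimes>\<^bsub>U\<^esub> ?h u = ?h (a # u)"
      using cons.hyps by (cases u) auto
    finally show ?case .
  qed
  show ?thesis
    unfolding hom_def
  proof (intro CollectI conjI ballI funcsetI)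
    fix u assume "u \<in> carrier (free_product S T)"
    then show "?h u \<in> carrier U"
      using closed by (auto simp: free_product_def)
  next
    fix u v
    assume u: "u \<in> carrier (free_product S T)" and v: "v \<in> carrier (free_product S T)"
    obtain b w where "v = b # w"
      using v by (cases v) (auto simp: free_product_def)
    then show "?h (u \<otimes>\<^bsub>free_product S T\<^esub> v) = ?h u \<otimes>\<^bsub>U\<^esub> ?h v"
      using mult[of u b w] u v by (auto simp: free_product_def)
  qed
qed

theorem free_product_universal:
  assumes "alg_semigroup S" and "alg_semigroup T" and "alg_semigroup U"
    and "f \<in> hom S U" and "g \<in> hom T U"
  shows "\<exists>h \<in> hom (free_product S T) U.
      (\<forall>x\<in>carrier S. h [Inl x] = f x) \<and> (\<forall>y\<in>carrier T. h [Inr y] = g y) \<and>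
      (\<forall>k \<in> hom (free_product S T) U.
         (\<forall>x\<in>carrier S. k [Inl x] = f x) \<and> (\<forall>y\<in>carrier T. k [Inr y] = g y) \<longrightarrow>
         (\<forall>w\<in>carrier (free_product S T). k w = h w))"
proof (intro bexI conjI ballI impI)
  show "lift_word U f g \<in> hom (free_product S T) U"
    using assms by (rule lift_word_hom)
next
  fix k w
  assume k: "k \<in> hom (free_product S T) U"
    and kfg: "(\<forall>x\<in>carrier S. k [Inl x] = f x) \<and> (\<forall>y\<in>carrier T. k [Inr y] = g y)"
  assume "w \<in> carrier (free_product S T)"
  then have "w \<noteq> []" "w \<in> carrier (free_product S T)"
    by (auto simp: free_product_def)
  then show "k w = lift_word U f g w"
  proof (induction w rule: list_nonempty_induct)
    case (single a)
    then show ?case using kfg by (cases a) (auto simp: free_product_def)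
  next
    case (cons a w)
    obtain b w' where w: "w = b # w'" using cons.hyps by (cases w) auto
    have mem: "[a] \<in> carrier (free_product S T)" "w \<in> carrier (free_product S T)"
      using cons.prems w by (auto simp: free_product_def)
    have "a # w = [a] \<otimes>\<^bsub>free_product S T\<^esub> w"
      using cons.prems w by (cases a; cases b) (auto simp: free_product_def)
    then have "k (a # w) = k [a] \<otimes>\<^bsub>U\<^esub> k w"
      using k mem by (simp add: hom_def)
    moreover have "k [a] = case_sum f g a"
      using kfg mem by (cases a) (auto simp: free_product_def)
    ultimately show ?case
      using cons.IH mem w by simp
  qed
qed auto

end

theory Submission
  imports Defs
begin

text \<open>
  Rename the generators of the two factors apart and take as normal forms the alternating
  concatenations of normal forms of the factors. As no cancellation to an empty block can occur in
  a product \<open>u v = w\<close>, only the last block \<open>x\<close> of \<open>u = u' x\<close> and the first block \<open>y\<close> of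
  \<open>v = y v'\<close> interact, so that the word \<open>u c v d (rev w)\<close> is either \<open>u c v d (rev v) (rev u)\<close>, or
  \<open>u' x c y v' d (rev v') (rev z) (rev u')\<close> where \<open>x c y d (rev z)\<close> is in the table of a factor.
  Both kinds reduce to a new symbol \<open>s\<close> under the monadic rules \<open>a d a \<rightarrow> d\<close>, \<open>a s a \<rightarrow> s\<close>,
  \<open>c d \<rightarrow> s\<close> and \<open>t \<rightarrow> s\<close> for \<open>t\<close> in the table of a factor. Conversely, every word of the form
  \<open>u c v d (rev w)\<close> that reduces to \<open>s\<close> satisfies \<open>\<pi> u \<otimes> \<pi> v = \<pi> w\<close>, even if the rules cut
  inside a block. Hence the table of the free product is the intersection of the ancestors of \<open>s\<close>
  with a regular language.
\<close>

section \<open>Regular languages via left quotients\<close>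

definition left_quotient :: "'a list \<Rightarrow> 'a list set \<Rightarrow> 'a list set" where
  "left_quotient x L = {y. x @ y \<in> L}"

text \<open>Myhill-Nerode: the quotient by \<open>x\<close> depends only on the state that
  \<open>x\<close> reaches, and conversely the quotients serve as states. The finite alphabet is a
  separate condition, since the set of all words over the naturals has just one quotient.\<close>

lemma regular_language_iff_finite_quotients:
  "regular_language L \<longleftrightarrow>
     (\<exists>A. finite A \<and> L \<subseteq> lists A) \<and> finite (range (\<lambda>x. left_quotient x L))"
  (is "_ \<longleftrightarrow> ?bounded \<and> finite ?Q")
proof (intro iffI conjI)
  assume "regular_language L"
  then obtain A and Q :: "nat set" and q0 \<delta> F
    where fin: "finite A" "finite Q" and q0: "q0 \<in> Q"
      and \<delta>: "\<And>q a. q \<in> Q \<Longrightarrow> a \<in> A \<Longrightarrow> \<delta> q a \<in> Q"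
      and L: "L = {w \<in> lists A. foldl \<delta> q0 w \<in> F}"
    unfolding regular_language_def by blast
  show ?bounded
    using fin(1) L by blast
  have run: "foldl \<delta> q x \<in> Q" if "x \<in> lists A" "q \<in> Q" for x q
    using that by (induction x arbitrary: q) (auto simp: \<delta>)
  \<comment> \<open>The extra \<open>{}\<close> is the quotient by words that leave the
    alphabet.\<close>
  have "?Q \<subseteq> insert {} ((\<lambda>q. {y \<in> lists A. foldl \<delta> q y \<in> F}) ` Q)"
  proof (rule image_subsetI)
    fix x :: word
    show "left_quotient x L \<in> insert {} ((\<lambda>q. {y \<in> lists A. foldl \<delta> q y \<in> F}) ` Q)"
    proof (cases "x \<in> lists A")
      case True
      then have "left_quotient x L = {y \<in> lists A. foldl \<delta> (foldl \<delta> q0 x) y \<in> F}"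
        by (auto simp: left_quotient_def L)
      then show ?thesis
        using run[OF True q0] by blast
    next
      case False
      then have "left_quotient x L = {}"
        by (auto simp: left_quotient_def L)
      then show ?thesis by simp
    qed
  qed
  then show "finite ?Q"
    by (rule finite_subset) (use fin in simp)
next
  assume *: "?bounded \<and> finite ?Q"
  then obtain A where A: "finite A" "L \<subseteq> lists A"
    by blast
  \<comment> \<open>States have to be naturals: \<open>f\<close> codes the quotients as numbers, and
    \<open>inv_into\<close> decodes them in \<delta>.\<close>
  obtain f :: "word set \<Rightarrow> nat" where f: "inj_on f ?Q"
    using * finite_imp_inj_to_nat_seg[of ?Q] by blast
  define \<delta> where "\<delta> q a = f (left_quotient [a] (inv_into ?Q f q))" for q a
  have step: "\<delta> (f (left_quotient x L)) a = f (left_quotient (x @ [a]) L)" for x a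
    using f by (simp add: \<delta>_def inv_into_f_f) (simp add: left_quotient_def)
  have run: "foldl \<delta> (f (left_quotient x L)) w = f (left_quotient (x @ w) L)" for x w
    by (induction w arbitrary: x) (auto simp: step)
  define F where "F = f ` {X \<in> ?Q. [] \<in> X}"
  have final: "f (left_quotient w L) \<in> F \<longleftrightarrow> w \<in> L" for w
  proof -
    have "f (left_quotient w L) \<in> F \<longleftrightarrow> left_quotient w L \<in> {X \<in> ?Q. [] \<in> X}"
      unfolding F_def by (rule inj_on_image_mem_iff[OF f]) auto
    then show ?thesis by (auto simp: left_quotient_def)
  qed
  have "L = {w \<in> lists A. foldl \<delta> (f (left_quotient [] L)) w \<in> F}"
    using A by (auto simp: run final)
  moreover have "\<forall>q\<in>f ` ?Q. \<forall>a\<in>A. \<delta> q a \<in> f ` ?Q"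
    by (auto simp: step)
  moreover have "F \<subseteq> f ` ?Q" by (auto simp: F_def)
  moreover have "finite (f ` ?Q)" "f (left_quotient [] L) \<in> f ` ?Q"
    using * by simp_all
  ultimately show "regular_language L"
    unfolding regular_language_def using A(1)
    by (intro exI[of _ A] exI[of _ "f ` ?Q"] exI[of _ "f (left_quotient [] L)"] exI[of _ \<delta>]
        exI[of _ F]) simp
qed

lemma regular_languageI:
  assumes "finite A" "L \<subseteq> lists A" "finite \<Q>" "\<And>x. left_quotient x L \<in> \<Q>"
  shows "regular_language L"
proof -
  have "range (\<lambda>x. left_quotient x L) \<subseteq> \<Q>"
    using assms(4) by blast
  then show ?thesis
    using assms(1-3) finite_subset unfolding regular_language_iff_finite_quotients by blast
qed

lemma regular_languageE:
  assumes "regular_language L"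
  obtains A where "finite A" "L \<subseteq> lists A" "finite (range (\<lambda>x. left_quotient x L))"
  using assms unfolding regular_language_iff_finite_quotients by blast

section \<open>Closure properties of regular languages\<close>

lemma regular_language_finite:
  assumes "finite L"
  shows "regular_language L"
proof (rule regular_languageI)
  show "finite (\<Union>w\<in>L. set w)" "L \<subseteq> lists (\<Union>w\<in>L. set w)"
    using assms by auto
  \<comment> \<open>All suffixes of words of \<open>L\<close>; every quotient is a set of
    these.\<close>
  let ?suf = "\<Union>w\<in>L. (\<lambda>k. drop k w) ` {..length w}"
  show "finite (Pow ?suf)"
    using assms by simp
  show "left_quotient x L \<in> Pow ?suf" for x
  proof -
    have "y \<in> ?suf" if "x @ y \<in> L" for y
      using that by (intro UN_I[of "x @ y"] image_eqI[of _ _ "length x"]) auto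
    then show ?thesis by (auto simp: left_quotient_def)
  qed
qed

lemma regular_language_Diff_finite:
  assumes "regular_language L" "finite F"
  shows "regular_language (L - F)"
proof -
  obtain A where A: "finite A" "L \<subseteq> lists A" "finite (range (\<lambda>x. left_quotient x L))"
    (is "finite ?QL")
    using assms(1) by (rule regular_languageE)
  have F: "finite (range (\<lambda>x. left_quotient x F))" (is "finite ?QF")
    using regular_language_finite[OF assms(2)] regular_languageE by metis
  show ?thesis
  proof (rule regular_languageI)
    show "finite A" "L - F \<subseteq> lists A"
      using A by auto
    show "finite ((\<lambda>(P, Q). P - Q) ` (?QL \<times> ?QF))"
      using A F by simp
    show "left_quotient x (L - F) \<in> (\<lambda>(P, Q). P - Q) ` (?QL \<times> ?QF)" for x
      by (rule image_eqI[of _ _ "(left_quotient x L, left_quotient x F)"])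
        (auto simp: left_quotient_def)
  qed
qed

lemma regular_language_Un:
  assumes "regular_language L" "regular_language K"
  shows "regular_language (L \<union> K)"
proof -
  obtain A where A: "finite A" "L \<subseteq> lists A" "finite (range (\<lambda>x. left_quotient x L))"
    (is "finite ?QL")
    using assms(1) by (rule regular_languageE)
  obtain B where B: "finite B" "K \<subseteq> lists B" "finite (range (\<lambda>x. left_quotient x K))"
    (is "finite ?QK")
    using assms(2) by (rule regular_languageE)
  show ?thesis
  proof (rule regular_languageI)
    show "finite (A \<union> B)" "L \<union> K \<subseteq> lists (A \<union> B)"
      using A B by auto
    show "finite ((\<lambda>(P, Q). P \<union> Q) ` (?QL \<times> ?QK))"
      using A B by simp
    show "left_quotient x (L \<union> K) \<in> (\<lambda>(P, Q). P \<union> Q) ` (?QL \<times> ?QK)" for x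
      by (rule image_eqI[of _ _ "(left_quotient x L, left_quotient x K)"])
        (auto simp: left_quotient_def)
  qed
qed

lemma lang_concatI: "u \<in> L \<Longrightarrow> v \<in> K \<Longrightarrow> u @ v \<in> lang_concat L K"
  unfolding lang_concat_def by blast

lemma lang_concatE:
  assumes "w \<in> lang_concat L K"
  obtains u v where "w = u @ v" "u \<in> L" "v \<in> K"
  using assms unfolding lang_concat_def by blast

text \<open>A cut after \<open>x\<close> falls into the part from \<open>L\<close> or the part from
  \<open>K\<close>. So the quotient is fixed by the quotient of \<open>L\<close> by \<open>x\<close>
  and the set of quotients of \<open>K\<close> by those \<open>z\<close> with
  \<open>x = y @ z\<close> and \<open>y \<in> L\<close>.\<close>

lemma regular_language_concat:
  assumes "regular_language L" "regular_language K"
  shows "regular_language (lang_concat L K)"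
proof -
  obtain A where A: "finite A" "L \<subseteq> lists A" "finite (range (\<lambda>x. left_quotient x L))"
    (is "finite ?QL")
    using assms(1) by (rule regular_languageE)
  obtain B where B: "finite B" "K \<subseteq> lists B" "finite (range (\<lambda>x. left_quotient x K))"
    (is "finite ?QK")
    using assms(2) by (rule regular_languageE)
  let ?F = "\<lambda>(P, \<S>). lang_concat P K \<union> \<Union>\<S>"
  show ?thesis
  proof (rule regular_languageI)
    show "finite (A \<union> B)"
      using A B by auto
    show "lang_concat L K \<subseteq> lists (A \<union> B)"
      using A(2) B(2) by (fastforce simp: lang_concat_def)
    show "finite (?F ` (?QL \<times> Pow ?QK))"
      using A B by simp
    fix x
    let ?S = "{left_quotient z K | y z. x = y @ z \<and> y \<in> L}"
    have "left_quotient x (lang_concat L K) = ?F (left_quotient x L, ?S)"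
    proof (intro subset_antisym subsetI)
      fix t assume "t \<in> left_quotient x (lang_concat L K)"
      then obtain u v where uv: "x @ t = u @ v" "u \<in> L" "v \<in> K"
        by (auto simp: left_quotient_def lang_concat_def)
      then consider r where "u = x @ r" "t = r @ v" | r where "x = u @ r" "v = r @ t"
        by (auto simp: append_eq_append_conv2)
      then show "t \<in> ?F (left_quotient x L, ?S)"
      proof cases
        case 1
        then show ?thesis using uv by (auto simp: left_quotient_def lang_concat_def)
      next
        case (2 r)
        then have "left_quotient r K \<in> ?S" "t \<in> left_quotient r K"
          using uv by (auto simp: left_quotient_def)
        then show ?thesis by auto
      qed
    next
      fix t assume "t \<in> ?F (left_quotient x L, ?S)"
      then consider r v where "t = r @ v" "x @ r \<in> L" "v \<in> K"
        | y z where "x = y @ z" "y \<in> L" "z @ t \<in> K"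
        by (auto simp: left_quotient_def lang_concat_def)
      then show "t \<in> left_quotient x (lang_concat L K)"
      proof cases
        case 1
        then have "x @ t = (x @ r) @ v" by simp
        then show ?thesis using 1 unfolding left_quotient_def lang_concat_def by blast
      next
        case 2
        then have "x @ t = y @ (z @ t)" by simp
        then show ?thesis using 2 unfolding left_quotient_def lang_concat_def by blast
      qed
    qed
    moreover have "(left_quotient x L, ?S) \<in> ?QL \<times> Pow ?QK"
      by auto
    ultimately show "left_quotient x (lang_concat L K) \<in> ?F ` (?QL \<times> Pow ?QK)"
      by (rule image_eqI)
  qed
qed

lemma lang_star_append: "u \<in> lang_star L \<Longrightarrow> v \<in> lang_star L \<Longrightarrow> u @ v \<in> lang_star L"
  unfolding lang_star_def
proof (elim imageE)
  fix us vs assume "u = concat us" "us \<in> lists L" "v = concat vs" "vs \<in> lists L"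
  then show "u @ v \<in> concat ` lists L"
    by (intro image_eqI[of _ _ "us @ vs"]) auto
qed

lemma lang_starI: "u \<in> L \<Longrightarrow> u \<in> lang_star L"
  unfolding lang_star_def by (rule image_eqI[of _ _ "[u]"]) auto

lemma Nil_in_lang_star: "[] \<in> lang_star L"
  unfolding lang_star_def by (rule image_eqI[of _ _ "[]"]) auto

text \<open>A cut after \<open>x\<close> falls inside some factor: its remainder lies in a quotient
  of \<open>L\<close>, the later factors in the star. The set of quotients of \<open>L\<close>
  arising this way determines the result up to the empty word.\<close>

lemma regular_language_star:
  assumes "regular_language L"
  shows "regular_language (lang_star L)"
proof -
  obtain A where A: "finite A" "L \<subseteq> lists A" "finite (range (\<lambda>x. left_quotient x L))"
    (is "finite ?Q")
    using assms by (rule regular_languageE)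
  let ?F = "\<lambda>(E, \<S>). E \<union> (\<Union>P\<in>\<S>. lang_concat P (lang_star L))"
  show ?thesis
  proof (rule regular_languageI)
    show "finite A" by (rule A)
    show "lang_star L \<subseteq> lists A"
      using A(2) by (fastforce simp: lang_star_def)
    show "finite (?F ` ({{}, {[]}} \<times> Pow ?Q))"
      using A by simp
    fix x :: word
    \<comment> \<open>Covers the empty list of factors, where there is nothing to cut.\<close>
    let ?E = "if x = [] then {[]} else {}"
    let ?S = "{left_quotient z L | y z. x = y @ z \<and> y \<in> lang_star L}"
    have "left_quotient x (lang_star L) = ?F (?E, ?S)"
    proof (intro subset_antisym subsetI)
      fix t assume "t \<in> left_quotient x (lang_star L)"
      then obtain ws where ws: "concat ws = x @ t" "ws \<in> lists L"
        unfolding left_quotient_def lang_star_def by (metis imageE mem_Collect_eq)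
      show "t \<in> ?F (?E, ?S)"
      proof (cases "ws = []")
        case True
        then show ?thesis using ws by simp
      next
        case False
        then obtain ws1 u v ws2 where "ws = ws1 @ (u @ v) # ws2"
          "x = concat ws1 @ u" "t = v @ concat ws2"
          using ws(1) by (auto simp: concat_eq_append_conv)
        then have mem: "u @ v \<in> L" "concat ws1 \<in> lang_star L" "concat ws2 \<in> lang_star L"
          and x: "x = concat ws1 @ u" and t: "t = v @ concat ws2"
          using ws(2) by (simp_all add: lang_star_def)
        have "left_quotient u L \<in> ?S"
          using mem(2) x by blast
        moreover have "t \<in> lang_concat (left_quotient u L) (lang_star L)"
          using mem(1,3) t unfolding lang_concat_def left_quotient_def by blast
        ultimately show ?thesis
          unfolding prod.case by (intro UnI2 UN_I)
      qed
    next
      fix t assume "t \<in> ?F (?E, ?S)"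
      then consider "x = []" "t = []"
        | y z v r where "x = y @ z" "y \<in> lang_star L" "z @ v \<in> L" "r \<in> lang_star L" "t = v @ r"
        by (auto simp: left_quotient_def lang_concat_def split: if_splits)
      then show "t \<in> left_quotient x (lang_star L)"
      proof cases
        case 1
        then show ?thesis by (simp add: left_quotient_def Nil_in_lang_star)
      next
        case 2
        then have "y @ (z @ v) @ r \<in> lang_star L"
          by (intro lang_star_append[OF _ lang_star_append] lang_starI[of "z @ v"])
        then show ?thesis using 2 by (simp add: left_quotient_def)
      qed
    qed
    moreover have "(?E, ?S) \<in> {{}, {[]}} \<times> Pow ?Q"
      by auto
    ultimately show "left_quotient x (lang_star L) \<in> ?F ` ({{}, {[]}} \<times> Pow ?Q)"
      by (rule image_eqI)
  qed
qed

text \<open>\<open>y\<close> lies in the quotient of the reversal by \<open>x\<close> iff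
  \<open>rev x\<close> lies in the quotient of \<open>L\<close> by \<open>rev y\<close>. So the set
  of quotients of \<open>L\<close> that contain \<open>rev x\<close> determines it.\<close>

lemma regular_language_rev:
  assumes "regular_language L"
  shows "regular_language (rev ` L)"
proof -
  obtain A where A: "finite A" "L \<subseteq> lists A" "finite (range (\<lambda>x. left_quotient x L))"
    (is "finite ?Q")
    using assms by (rule regular_languageE)
  let ?F = "\<lambda>\<S>. {y. left_quotient (rev y) L \<in> \<S>}"
  show ?thesis
  proof (rule regular_languageI)
    show "finite A" by (rule A)
    show "rev ` L \<subseteq> lists A"
      using A(2) by fastforce
    show "finite (?F ` Pow ?Q)"
      using A by simp
    fix x
    have "rev ` L = {z. rev z \<in> L}"
      by (auto intro: image_eqI[of z rev "rev z" L for z])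
    then have "left_quotient x (rev ` L) = ?F {P \<in> ?Q. rev x \<in> P}"
      by (auto simp: left_quotient_def)
    then show "left_quotient x (rev ` L) \<in> ?F ` Pow ?Q"
      by blast
  qed
qed

lemma regular_language_map:
  assumes "regular_language L" "inj h"
  shows "regular_language (map h ` L)"
proof -
  obtain A where A: "finite A" "L \<subseteq> lists A" "finite (range (\<lambda>x. left_quotient x L))"
    (is "finite ?Q")
    using assms(1) by (rule regular_languageE)
  show ?thesis
  proof (rule regular_languageI)
    show "finite (h ` A)" using A by simp
    have "map h w \<in> lists (h ` A)" if "w \<in> lists A" for w
      using that by auto
    then show "map h ` L \<subseteq> lists (h ` A)"
      using A by blast
    show "finite (insert {} ((`) (map h) ` ?Q))"
      using A by simp
    fix x
    show "left_quotient x (map h ` L) \<in> insert {} ((`) (map h) ` ?Q)"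
    proof (cases "x \<in> range (map h)")
      case True
      then obtain x' where x: "x = map h x'" by blast
      have "left_quotient x (map h ` L) = map h ` left_quotient x' L"
        using assms(2)
        by (auto simp: left_quotient_def x append_eq_map_conv map_eq_append_conv inj_map_eq_map
            image_iff)
      then show ?thesis by blast
    next
      case False
      then have "left_quotient x (map h ` L) = {}"
        by (auto simp: left_quotient_def append_eq_map_conv)
      then show ?thesis by simp
    qed
  qed
qed

section \<open>Full AFLs\<close>

text \<open>Intersecting a member with \<open>{}\<close> gives \<open>{}\<close>, whose star is
  \<open>{[]}\<close>; the preimage of that under the erasing homomorphism is
  \<open>lists A\<close>, which is then cut down to \<open>R\<close>. A member is required to start
  from, as the empty class satisfies all closure conditions vacuously.\<close>

lemma full_AFL_regular:
  assumes C: "full_AFL C" "C \<noteq> {}" and "regular_language R"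
  shows "R \<in> C"
proof -
  obtain L where "L \<in> C" using C(2) by blast
  then have "L \<inter> {} \<in> C"
    using C(1) regular_language_finite[of "{}"] unfolding full_AFL_def by blast
  then have "lang_star {} \<in> C"
    using C(1) unfolding full_AFL_def by simp
  then have Nil: "{[]} \<in> C"
    by (simp add: lang_star_def)
  obtain A where A: "finite A" "R \<subseteq> lists A"
    using assms(3) by (rule regular_languageE)
  have "{w \<in> lists A. word_hom (\<lambda>_. []) w \<in> {[]}} \<in> C"
    using C(1) Nil A(1) unfolding full_AFL_def by blast
  then have "lists A \<in> C"
    by (simp add: word_hom_def)
  then have "lists A \<inter> R \<in> C"
    using C(1) assms(3) unfolding full_AFL_def by blast
  then show ?thesis using A(2) by (simp add: Int_absorb1)
qed

lemma full_AFL_Un: "full_AFL C \<Longrightarrow> L \<in> C \<Longrightarrow> K \<in> C \<Longrightarrow> L \<union> K \<in> C"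
  unfolding full_AFL_def by blast

section \<open>Homomorphisms from free semigroups\<close>

text \<open>Homomorphic extension of a letter assignment. The recursion ends at one letter because a
  semigroup offers no unit as value at \<open>[]\<close>.\<close>

fun word_product :: "('a, 'm) monoid_scheme \<Rightarrow> (nat \<Rightarrow> 'a) \<Rightarrow> word \<Rightarrow> 'a" where
  "word_product U g [] = undefined"
| "word_product U g [a] = g a"
| "word_product U g (a # b # w) = g a \<otimes>\<^bsub>U\<^esub> word_product U g (b # w)"

lemma word_product_hom:
  assumes "alg_semigroup U" and g: "g ` A \<subseteq> carrier U"
  shows "word_product U g \<in> hom (free_semigroup A) U"
proof -
  interpret U: alg_semigroup U by fact
  let ?p = "word_product U g"
  have Cons: "?p (a # w) = g a \<otimes>\<^bsub>U\<^esub> ?p w" if "w \<noteq> []" for a w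
    using that by (cases w) auto
  have closed: "?p w \<in> carrier U" if "w \<noteq> []" "w \<in> lists A" for w
    using that
  proof (induction w rule: list_nonempty_induct)
    case (single a)
    then show ?case using g by auto
  next
    case (cons a w)
    then show ?case using g U.mult_closed by (auto simp: Cons)
  qed
  have "?p (u @ v) = ?p u \<otimes>\<^bsub>U\<^esub> ?p v" if "u \<noteq> []" "u \<in> lists A" "v \<noteq> []" "v \<in> lists A" for u v
    using that(1,2)
  proof (induction u rule: list_nonempty_induct)
    case (single a)
    then show ?case using that by (simp add: Cons)
  next
    case (cons a u)
    then have "g a \<in> carrier U" "?p u \<in> carrier U" "?p v \<in> carrier U"
      using g closed that by auto
    then show ?case
      using cons that by (simp add: Cons U.mult_assoc)
  qed
  then show ?thesis
    using closed by (auto simp: hom_def free_semigroup_def)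
qed

lemma free_semigroup_hom_ext:
  assumes f: "f \<in> hom (free_semigroup A) U" and g: "g \<in> hom (free_semigroup A) U"
    and letters: "\<And>a. a \<in> A \<Longrightarrow> f [a] = g [a]"
    and "w \<noteq> []" "w \<in> lists A"
  shows "f w = g w"
  using assms(4,5)
proof (induction w rule: list_nonempty_induct)
  case (single a)
  then show ?case using letters by simp
next
  case (cons a w)
  have "k (a # w) = k [a] \<otimes>\<^bsub>U\<^esub> k w" if "k \<in> hom (free_semigroup A) U" for k
    using hom_mult[OF that, of "[a]" w] cons.hyps cons.prems by (simp add: free_semigroup_def)
  from this[OF f] this[OF g] show ?case using letters cons by simp
qed

lemma free_semigroup_hom_map:
  assumes f: "f \<in> hom (free_semigroup B) U" and "h ` A \<subseteq> B"
  shows "(\<lambda>w. f (map h w)) \<in> hom (free_semigroup A) U"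
proof -
  have mem: "map h w \<in> carrier (free_semigroup B)" if "w \<in> carrier (free_semigroup A)" for w
    using that assms(2) by (fastforce simp: free_semigroup_def in_lists_conv_set)
  then show ?thesis
    using f by (auto simp: hom_def free_semigroup_def Pi_iff)
qed

section \<open>The multiplication table as a set of ancestors\<close>

text \<open>
  \<open>n a\<close> is the normal form of the single letter \<open>a\<close> of the free product.
\<close>

locale product_encoding =
  fixes S :: "('a, 'm) monoid_scheme" and T :: "('b, 'n) monoid_scheme"
    and A :: "nat set" and \<pi> :: "word \<Rightarrow> ('a + 'b) list" and n :: "'a + 'b \<Rightarrow> word"
    and c d s :: nat
  assumes semigroup_S: "alg_semigroup S" and semigroup_T: "alg_semigroup T"
    and finite_A: "finite A"
    and fresh: "c \<notin> A" "d \<notin> A" "s \<notin> A" "c \<noteq> d" "c \<noteq> s" "d \<noteq> s"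
    and \<pi>_hom: "\<pi> \<in> hom (free_semigroup A) (free_product S T)"
    and n_mem: "\<And>a. a \<in> carrier S <+> carrier T \<Longrightarrow> n a \<in> lists A"
    and n_Nil: "\<And>a. a \<in> carrier S <+> carrier T \<Longrightarrow> n a \<noteq> []"
    and \<pi>_n: "\<And>a. a \<in> carrier S <+> carrier T \<Longrightarrow> \<pi> (n a) = [a]"
begin

abbreviation U where "U \<equiv> free_product S T"
abbreviation X where "X \<equiv> carrier S <+> carrier T"

sublocale U: alg_semigroup U
  by (rule free_product_semigroup[OF semigroup_S semigroup_T])

section \<open>Normal forms of alternating words\<close>

definition nf :: "('a + 'b) list \<Rightarrow> word" where
  "nf w = concat (map n w)"

lemma nf_simps [simp]: "nf [] = []" "nf (a # w) = n a @ nf w" "nf (v @ w) = nf v @ nf w"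
  by (auto simp: nf_def)

lemma nf_mem: "w \<in> lists X \<Longrightarrow> nf w \<in> lists A"
  by (induction w) (use n_mem in auto)

lemma carrier_U: "w \<in> carrier U \<longleftrightarrow> w \<in> lists X \<and> w \<noteq> [] \<and> successively (\<lambda>a b. isl a \<noteq> isl b) w"
  by (auto simp: free_product_def)

lemma nf_carrier:
  assumes "w \<in> carrier U"
  shows "nf w \<in> lists A" "nf w \<noteq> []"
proof -
  show "nf w \<in> lists A" using assms nf_mem by (simp add: carrier_U)
  show "nf w \<noteq> []" using assms n_Nil by (cases w) (auto simp: carrier_U)
qed

lemma \<pi>_append:
  assumes "u \<in> lists A" "u \<noteq> []" "v \<in> lists A" "v \<noteq> []"
  shows "\<pi> (u @ v) = \<pi> u \<otimes>\<^bsub>U\<^esub> \<pi> v"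
  using hom_mult[OF \<pi>_hom, of u v] assms by (simp add: free_semigroup_def)

lemma \<pi>_closed:
  assumes "u \<in> lists A" "u \<noteq> []"
  shows "\<pi> u \<in> carrier U"
  using hom_in_carrier[OF \<pi>_hom, of u] assms by (simp add: free_semigroup_def)

text \<open>Multiplying by \<open>[a]\<close> from the left merely prefixes \<open>a\<close>,
  because the next letter comes from the other factor. This yields both the surjectivity of \<pi>
  and the uniqueness of normal forms.\<close>

lemma \<pi>_nf: "w \<in> carrier U \<Longrightarrow> \<pi> (nf w) = w"
proof (induction w)
  case Nil
  then show ?case by (simp add: carrier_U)
next
  case (Cons a w)
  show ?case
  proof (cases "w = []")
    case True
    then show ?thesis using Cons.prems \<pi>_n by (simp add: carrier_U)
  next
    case False
    then obtain b w' where w: "w = b # w'" by (cases w) auto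
    have a: "a \<in> X" and "w \<in> carrier U"
      using Cons.prems w by (auto simp: carrier_U)
    then have "\<pi> (nf (a # w)) = [a] \<otimes>\<^bsub>U\<^esub> w"
      using \<pi>_append[of "n a" "nf w"] n_mem[OF a] n_Nil[OF a] nf_carrier[of w] \<pi>_n[OF a] Cons.IH
      by simp
    also have "\<dots> = a # w"
      using Cons.prems w by (cases a; cases b) (auto simp: free_product_def)
    finally show ?thesis .
  qed
qed

section \<open>The monadic rewriting system\<close>

text \<open>The union of the two factor tables, coded by \<open>n\<close>: \<open>join\<close>
  returns a single letter exactly when both letters come from the same factor.\<close>

definition letter_table :: lang where
  "letter_table = {n a @ [c] @ n b @ [d] @ rev (n e) | a b e. a \<in> X \<and> b \<in> X \<and> join S T a b = [e]}"

lemma letter_tableI: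
  "a \<in> X \<Longrightarrow> b \<in> X \<Longrightarrow> join S T a b = [e] \<Longrightarrow>
    n a @ [c] @ n b @ [d] @ rev (n e) \<in> letter_table"
  unfolding letter_table_def by blast

text \<open>Mirror letters around \<open>d\<close> cancel a common end of \<open>v\<close> and
  \<open>w\<close>, those around \<open>s\<close> a common beginning of \<open>u\<close> and
  \<open>w\<close>. The other rules switch phase: \<open>[c, d]\<close> when \<open>v\<close> is
  used up, a table entry when two letters are multiplied.\<close>

definition rules :: "(word \<times> word) set" where
  "rules = {([a, d, a], [d]) | a. a \<in> A} \<union> {([a, s, a], [s]) | a. a \<in> A} \<union> {([c, d], [s])}
     \<union> letter_table \<times> {[s]}"

abbreviation B where "B \<equiv> insert c (insert d (insert s A))"

abbreviation step (infix "\<leadsto>" 50) where "u \<leadsto> v \<equiv> (u, v) \<in> rewrite_step B rules"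
abbreviation steps (infix "\<leadsto>*" 50) where "u \<leadsto>* v \<equiv> (u, v) \<in> (rewrite_step B rules)\<^sup>*"

lemma A_subset_B: "w \<in> lists A \<Longrightarrow> w \<in> lists B"
  by (auto simp: in_lists_conv_set)

lemma join_single:
  assumes "a \<in> X" "b \<in> X" "join S T a b = [e]"
  shows "e \<in> X" "[a] \<otimes>\<^bsub>U\<^esub> [b] = [e]"
  using assms alg_semigroup.mult_closed[OF semigroup_S] alg_semigroup.mult_closed[OF semigroup_T]
  by (cases a; cases b; auto simp: free_product_def)+

lemma letter_table_subset: "letter_table \<subseteq> lists B"
proof
  fix w assume "w \<in> letter_table"
  then obtain a b e where w: "w = n a @ [c] @ n b @ [d] @ rev (n e)"
    and ab: "a \<in> X" "b \<in> X" "join S T a b = [e]"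
    by (auto simp: letter_table_def)
  note mem = ab(1,2) join_single(1)[OF ab]
  show "w \<in> lists B"
    using mem[THEN n_mem, THEN A_subset_B] by (auto simp: w in_lists_conv_set)
qed

lemma monadic_rules: "monadic B rules"
proof -
  have "length u \<ge> 1" if "u \<in> letter_table" for u
    using that by (auto simp: letter_table_def)
  then show ?thesis
    unfolding monadic_def using letter_table_subset by (fastforce simp: rules_def)
qed

text \<open>Only \<open>[d]\<close> and \<open>[s]\<close> occur on the right, and the left-hand
  sides outside \<open>letter_table\<close> form finite sets. Membership of
  \<open>letter_table\<close> also makes \<open>C\<close> nonempty, so that finite languages belong
  to it.\<close>

lemma class_monadic_rules:
  assumes C: "full_AFL C" and table: "letter_table \<in> C"
  shows "class_monadic C B rules"
proof -
  have finite: "L \<in> C" if "finite L" for L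
    using full_AFL_regular[OF C] regular_language_finite[OF that] table by blast
  have "{u. (u, []) \<in> rules} = {}"
    by (auto simp: rules_def)
  moreover have "{u. (u, [a]) \<in> rules} \<in> C" if "a \<in> B" for a
  proof -
    let ?D = "(\<lambda>a. [a, d, a]) ` A" and ?E = "insert [c, d] ((\<lambda>a. [a, s, a]) ` A)"
    have "{u. (u, [a]) \<in> rules} =
        (if a = d then ?D else if a = s then ?E \<union> letter_table else {})"
      using fresh by (auto simp: rules_def)
    moreover have "?E \<union> letter_table \<in> C"
      using finite[of ?E] finite_A table by (intro full_AFL_Un[OF C]) auto
    ultimately show ?thesis
      using finite[of ?D] finite[of "{}"] finite_A by simp
  qed
  ultimately show ?thesis
    using monadic_rules finite[of "{}"] by (simp add: class_monadic_def)
qed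

section \<open>Reduction of products to \<open>s\<close>\<close>

lemma stepI: "(l, r) \<in> rules \<Longrightarrow> x \<in> lists B \<Longrightarrow> y \<in> lists B \<Longrightarrow> x @ l @ y \<leadsto> x @ r @ y"
  unfolding rewrite_step_def by blast

text \<open>Cancellation runs from the centre outwards. The outer letter of \<open>v\<close> joins
  the context for the induction hypothesis and is cancelled last, hence the arbitrary
  \<open>x\<close> and \<open>y\<close>.\<close>

lemma steps_d:
  assumes "v \<in> lists A" "x \<in> lists B" "y \<in> lists B"
  shows "x @ v @ [d] @ rev v @ y \<leadsto>* x @ [d] @ y"
  using assms
proof (induction v arbitrary: x y)
  case Nil
  then show ?case by simp
next
  case (Cons a v)
  have a: "a \<in> A" by fact
  have "(x @ [a]) @ v @ [d] @ rev v @ ([a] @ y) \<leadsto>* (x @ [a]) @ [d] @ ([a] @ y)"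
    by (rule Cons.IH) (use Cons.prems a in auto)
  moreover have "x @ [a, d, a] @ y \<leadsto> x @ [d] @ y"
    by (rule stepI) (use Cons.prems a in \<open>auto simp: rules_def\<close>)
  ultimately show ?case by (simp add: rtrancl.rtrancl_into_rtrancl)
qed

text \<open>Induction from the right end cancels the letter next to \<open>s\<close> first, so the
  statement can do without a context.\<close>

lemma steps_s:
  assumes "u \<in> lists A"
  shows "u @ [s] @ rev u \<leadsto>* [s]"
  using assms
proof (induction u rule: rev_induct)
  case Nil
  then show ?case by simp
next
  case (snoc a u)
  then have "a \<in> A" "u \<in> lists A" by auto
  then have "u @ [a, s, a] @ rev u \<leadsto> u @ [s] @ rev u"
    by (intro stepI A_subset_B) (auto simp: rules_def)
  then show ?case
    using snoc by (auto intro: converse_rtrancl_into_rtrancl)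
qed

lemma steps_product:
  assumes u: "u \<in> carrier U" and v: "v \<in> carrier U"
  shows "nf u @ [c] @ nf v @ [d] @ rev (nf (u \<otimes>\<^bsub>U\<^esub> v)) \<leadsto>* [s]"
proof -
  obtain u' a where ua: "u = u' @ [a]"
    using u by (cases u rule: rev_cases) (auto simp: carrier_U)
  obtain b v' where vb: "v = b # v'"
    using v by (cases v) (auto simp: carrier_U)
  have mult: "u \<otimes>\<^bsub>U\<^esub> v = u' @ join S T a b @ v'"
    by (simp add: ua vb free_product_def)
  have ab: "a \<in> X" "b \<in> X" and uv': "nf u' \<in> lists A" "nf v' \<in> lists A"
    using u v nf_mem[of u'] nf_mem[of v'] by (auto simp: carrier_U ua vb)
  note n_ab = n_mem[OF ab(1)] n_mem[OF ab(2)]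
  show ?thesis
  proof (cases "\<exists>e. join S T a b = [e]")
    case True
    then obtain e where e: "join S T a b = [e]" by blast
    have n_e: "n e \<in> lists A"
      using n_mem[OF join_single(1)[OF ab e]] .
    have "(n a @ [c] @ n b @ [d] @ rev (n e), [s]) \<in> rules"
      using letter_tableI[OF ab e] unfolding rules_def by blast
    then have letters:
      "nf u' @ (n a @ [c] @ n b @ [d] @ rev (n e)) @ rev (nf u') \<leadsto> nf u' @ [s] @ rev (nf u')"
      by (rule stepI) (use uv' A_subset_B in auto)
    \<comment> \<open>The right context is what remains of the reversed normal form of
      \<open>u' @ e # v'\<close> after \<open>nf v'\<close> has been cancelled.\<close>
    have "(nf u' @ n a @ [c] @ n b) @ nf v' @ [d] @ rev (nf v') @ (rev (n e) @ rev (nf u'))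
        \<leadsto>* (nf u' @ n a @ [c] @ n b) @ [d] @ (rev (n e) @ rev (nf u'))"
      by (rule steps_d) (use uv' n_ab n_e A_subset_B in auto)
    also have "(nf u' @ n a @ [c] @ n b) @ [d] @ (rev (n e) @ rev (nf u'))
        \<leadsto>* nf u' @ [s] @ rev (nf u')"
      using letters by auto
    also have "nf u' @ [s] @ rev (nf u') \<leadsto>* [s]"
      using uv'(1) by (rule steps_s)
    finally show ?thesis
      unfolding mult e by (simp add: ua vb)
  next
    case False
    then have e: "join S T a b = [a, b]"
      by (cases a; cases b) auto
    have letters: "nf u @ [c, d] @ rev (nf u) \<leadsto> nf u @ [s] @ rev (nf u)"
      by (rule stepI) (use nf_carrier[OF u] A_subset_B in \<open>auto simp: rules_def\<close>)
    have "(nf u @ [c]) @ nf v @ [d] @ rev (nf v) @ rev (nf u) \<leadsto>* (nf u @ [c]) @ [d] @ rev (nf u)"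
      by (rule steps_d) (use nf_carrier[OF u] nf_carrier[OF v] A_subset_B in auto)
    also have "(nf u @ [c]) @ [d] @ rev (nf u) \<leadsto>* nf u @ [s] @ rev (nf u)"
      using letters by auto
    also have "nf u @ [s] @ rev (nf u) \<leadsto>* [s]"
      using nf_carrier[OF u] by (intro steps_s)
    finally show ?thesis
      unfolding mult e by (simp add: ua vb)
  qed
qed

section \<open>Soundness of the reductions\<close>

text \<open>
  Quantifying over the contexts \<open>p\<close> and \<open>q\<close> gives a meaning to the equation \<open>\<pi> u \<otimes> \<pi> v = \<pi> w\<close> also
  for empty words, on which \<open>\<pi>\<close> is junk, and makes it stable under the rules
  \<open>a d a \<rightarrow> d\<close> and \<open>a s a \<rightarrow> s\<close>.
\<close>

definition multiplies :: "word \<Rightarrow> word \<Rightarrow> word \<Rightarrow> bool" where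
  "multiplies u v w \<longleftrightarrow> u \<in> lists A \<and> v \<in> lists A \<and> w \<in> lists A \<and>
     (\<forall>p\<in>lists A. \<forall>q\<in>lists A. p @ u \<noteq> [] \<longrightarrow> v @ q \<noteq> [] \<longrightarrow>
        \<pi> (p @ u) \<otimes>\<^bsub>U\<^esub> \<pi> (v @ q) = \<pi> (p @ w @ q))"

lemma multiplies_Nil: "multiplies [] [] []"
  by (simp add: multiplies_def \<pi>_append)

lemma multiplies_context:
  assumes "multiplies u v w" "x \<in> lists A" "y \<in> lists A"
  shows "multiplies (x @ u) (v @ y) (x @ w @ y)"
proof -
  have "\<pi> ((p @ x) @ u) \<otimes>\<^bsub>U\<^esub> \<pi> (v @ (y @ q)) = \<pi> ((p @ x) @ w @ (y @ q))"
    if "p \<in> lists A" "q \<in> lists A" "(p @ x) @ u \<noteq> []" "v @ (y @ q) \<noteq> []" for p q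
  proof -
    have "p @ x \<in> lists A" "y @ q \<in> lists A"
      using that assms(2,3) by simp_all
    then show ?thesis
      using assms(1) that(3,4) unfolding multiplies_def by blast
  qed
  then show ?thesis
    using assms by (simp add: multiplies_def)
qed

text \<open>Associativity carries the equation for two letters into any context. Empty
  \<open>p\<close> and \<open>q\<close> are separate cases because \<pi> is multiplicative on
  nonempty words only.\<close>

lemma multiplies_letters:
  assumes "a \<in> X" "b \<in> X" "join S T a b = [e]"
  shows "multiplies (n a) (n b) (n e)"
proof -
  have e: "e \<in> X" "[a] \<otimes>\<^bsub>U\<^esub> [b] = [e]"
    using join_single[OF assms] by auto
  note mem = n_mem[OF assms(1)] n_mem[OF assms(2)] n_mem[OF e(1)]
    and Nil = n_Nil[OF assms(1)] n_Nil[OF assms(2)] n_Nil[OF e(1)]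
  have ab: "\<pi> (n a) \<otimes>\<^bsub>U\<^esub> \<pi> (n b) = \<pi> (n e)"
    using assms e by (simp add: \<pi>_n)
  have right: "\<pi> (n a) \<otimes>\<^bsub>U\<^esub> \<pi> (n b @ q) = \<pi> (n e @ q)" if "q \<in> lists A" for q
    using that ab mem Nil
    by (cases "q = []") (simp_all add: \<pi>_append \<pi>_closed U.mult_assoc[symmetric])
  have "\<pi> (p @ n a) \<otimes>\<^bsub>U\<^esub> \<pi> (n b @ q) = \<pi> (p @ n e @ q)" if "p \<in> lists A" "q \<in> lists A" for p q
    using that right[of q] mem Nil
    by (cases "p = []")
      (simp_all add: \<pi>_append[of p] \<pi>_closed U.mult_assoc)
  then show ?thesis
    using mem by (simp add: multiplies_def)
qed

text \<open>Invariant for reading reductions to \<open>[s]\<close> backwards: the first shape still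
  contains \<open>s\<close>; in the second, the step that created \<open>s\<close> has been
  undone.\<close>

definition sound_form :: "word \<Rightarrow> bool" where
  "sound_form x \<longleftrightarrow> (\<exists>p\<in>lists A. x = p @ [s] @ rev p) \<or>
     (\<exists>u v w. multiplies u v w \<and> x = u @ [c] @ v @ [d] @ rev w)"

text \<open>The right-hand word contains \<open>z\<close> only once, which fixes the cut. The
  conditions are on \<open>x'\<close> and \<open>y'\<close>, since \<open>x\<close> and
  \<open>y\<close> may be unknown contexts of a rewriting step.\<close>

lemma append_Cons_eq_unique:
  assumes "x @ z # y = x' @ z # y'" "z \<notin> set x'" "z \<notin> set y'"
  shows "x = x' \<and> y = y'"
  using assms by (auto simp: append_eq_append_conv2 append_eq_Cons_conv Cons_eq_append_conv)

lemma multiplies_sets: "multiplies u v w \<Longrightarrow> set u \<subseteq> A \<and> set v \<subseteq> A \<and> set w \<subseteq> A"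
  by (auto simp: multiplies_def)

lemma sound_form_s:
  assumes "sound_form (x @ [s] @ y)"
  shows "x \<in> lists A \<and> y = rev x"
proof -
  have "\<not> (multiplies u v w \<and> x @ [s] @ y = u @ [c] @ v @ [d] @ rev w)" for u v w
  proof
    assume *: "multiplies u v w \<and> x @ [s] @ y = u @ [c] @ v @ [d] @ rev w"
    then have "s \<in> set (u @ [c] @ v @ [d] @ rev w)"
      by (metis in_set_conv_decomp append_Cons append_Nil)
    then show False using multiplies_sets[of u v w] * fresh by auto
  qed
  then obtain p where "p \<in> lists A" "x @ [s] @ y = p @ [s] @ rev p"
    using assms by (auto simp: sound_form_def)
  then show ?thesis
    using append_Cons_eq_unique[of x s y p "rev p"] fresh by auto
qed

lemma sound_form_d:
  assumes "sound_form (x @ [d] @ y)"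
  obtains u v w where "multiplies u v w" "x = u @ [c] @ v" "y = rev w"
proof -
  have "\<not> (p \<in> lists A \<and> x @ [d] @ y = p @ [s] @ rev p)" for p
  proof
    assume *: "p \<in> lists A \<and> x @ [d] @ y = p @ [s] @ rev p"
    then have "d \<in> set (p @ [s] @ rev p)"
      by (metis in_set_conv_decomp append_Cons append_Nil)
    then show False using * fresh by auto
  qed
  then obtain u v w where *: "multiplies u v w" "x @ [d] @ y = u @ [c] @ v @ [d] @ rev w"
    using assms by (auto simp: sound_form_def)
  have "x = u @ [c] @ v \<and> y = rev w"
    by (rule append_Cons_eq_unique[of x d y]) (use * multiplies_sets[OF *(1)] fresh in auto)
  then show ?thesis using that * by blast
qed

text \<open>Undoing \<open>a d a\<close> extends \<open>v\<close> and \<open>w\<close> by the same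
  letter, undoing \<open>a s a\<close> lengthens \<open>p\<close>, and undoing a rule that creates
  \<open>s\<close> passes to the second shape. Cuts inside a block do no harm, as
  \<open>multiplies\<close> speaks of arbitrary words over \<open>A\<close>.\<close>

lemma sound_form_step:
  assumes "x \<leadsto> y" "sound_form y"
  shows "sound_form x"
proof -
  obtain p l r q where lr: "(l, r) \<in> rules" and x: "x = p @ l @ q" and y: "y = p @ r @ q"
    using assms(1) unfolding rewrite_step_def by blast
  consider a where "a \<in> A" "l = [a, d, a]" "r = [d]"
    | a where "a \<in> A" "l = [a, s, a]" "r = [s]"
    | "l = [c, d]" "r = [s]" | "l \<in> letter_table" "r = [s]"
    using lr unfolding rules_def by blast
  then show ?thesis
  proof cases
    case (1 a)
    then obtain u v w where w: "multiplies u v w" "p = u @ [c] @ v" "q = rev w"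
      using assms(2) y sound_form_d by blast
    have "multiplies u (v @ [a]) (w @ [a])"
      using multiplies_context[OF w(1), of "[]" "[a]"] 1 by simp
    moreover have "x = u @ [c] @ (v @ [a]) @ [d] @ rev (w @ [a])"
      using w x 1 by simp
    ultimately show ?thesis unfolding sound_form_def by blast
  next
    case (2 a)
    then have "p \<in> lists A" "q = rev p"
      using assms(2) y sound_form_s by blast+
    then have "p @ [a] \<in> lists A" "x = (p @ [a]) @ [s] @ rev (p @ [a])"
      using 2 x by auto
    then show ?thesis unfolding sound_form_def by blast
  next
    case 3
    then have p: "p \<in> lists A" "q = rev p"
      using assms(2) y sound_form_s by blast+
    \<comment> \<open>The middle word is empty, where \<pi> is junk; the quantified right contexts
      in \<open>multiplies\<close> give this instance its meaning.\<close>
    then have "multiplies p [] p" "x = p @ [c] @ [] @ [d] @ rev p"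
      using multiplies_context[OF multiplies_Nil, of p "[]"] 3 x by auto
    then show ?thesis unfolding sound_form_def by blast
  next
    case 4
    then have p: "p \<in> lists A" "q = rev p"
      using assms(2) y sound_form_s by blast+
    obtain a b e where abe: "a \<in> X" "b \<in> X" "join S T a b = [e]"
      and l: "l = n a @ [c] @ n b @ [d] @ rev (n e)"
      using 4 by (auto simp: letter_table_def)
    have "multiplies (p @ n a) (n b) (p @ n e)"
      using multiplies_context[OF multiplies_letters[OF abe], of p "[]"] p by simp
    moreover have "x = (p @ n a) @ [c] @ n b @ [d] @ rev (p @ n e)"
      using x l p by simp
    ultimately show ?thesis unfolding sound_form_def by blast
  qed
qed

lemma sound_form_steps: "x \<leadsto>* [s] \<Longrightarrow> sound_form x"
proof (induction rule: converse_rtrancl_induct)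
  case base
  show ?case unfolding sound_form_def by (intro disjI1 bexI[of _ "[]"]) auto
next
  case (step x y)
  then show ?case using sound_form_step by blast
qed

section \<open>The table as an intersection, and regularity of the normal forms\<close>

abbreviation R where "R \<equiv> nf ` carrier U"

text \<open>The regular language forces the three parts to be normal forms. Soundness supplies some
  cut of \<open>x\<close>, which the unique positions of \<open>c\<close> and \<open>d\<close>
  identify with the cut into these parts.\<close>

lemma mult_table_eq_ancestors:
  "mult_table U \<pi> c d R =
     ancestors B rules {[s]} \<inter>
       lang_concat R (lang_concat {[c]} (lang_concat R (lang_concat {[d]} (rev ` R))))"
  (is "_ = _ \<inter> ?K")
proof (intro subset_antisym subsetI)
  fix x assume "x \<in> mult_table U \<pi> c d R"
  then obtain u v w where mem: "u \<in> carrier U" "v \<in> carrier U" "w \<in> carrier U"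
    and x: "x = nf u @ [c] @ nf v @ [d] @ rev (nf w)" and w: "u \<otimes>\<^bsub>U\<^esub> v = w"
    unfolding mult_table_def by (auto simp: \<pi>_nf)
  have "x \<in> lists B"
    using nf_carrier[OF mem(1)] nf_carrier[OF mem(2)] nf_carrier[OF mem(3)] A_subset_B
    by (auto simp: x)
  moreover have "x \<leadsto>* [s]"
    using steps_product[OF mem(1,2)] by (simp add: x w)
  moreover have "x \<in> ?K"
    using mem unfolding x by (intro lang_concatI imageI) simp_all
  ultimately show "x \<in> ancestors B rules {[s]} \<inter> ?K"
    by (auto simp: ancestors_def)
next
  fix x assume "x \<in> ancestors B rules {[s]} \<inter> ?K"
  then have "sound_form x" and "x \<in> ?K"
    by (auto simp: ancestors_def sound_form_steps)
  then obtain u v w where mem: "u \<in> carrier U" "v \<in> carrier U" "w \<in> carrier U"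
    and x: "x = nf u @ [c] @ nf v @ [d] @ rev (nf w)"
    unfolding lang_concat_def by blast
  have "sound_form ((nf u @ [c] @ nf v) @ [d] @ rev (nf w))"
    using \<open>sound_form x\<close> by (simp add: x)
  then obtain u' v' w' where m: "multiplies u' v' w'"
    and eq: "nf u @ [c] @ nf v = u' @ [c] @ v'" "rev (nf w) = rev w'"
    by (rule sound_form_d)
  have "nf u = u' \<and> nf v = v'"
    by (rule append_Cons_eq_unique[of _ c]) (use eq multiplies_sets[OF m] fresh in auto)
  then have "multiplies (nf u) (nf v) (nf w)"
    using m eq by simp
  \<comment> \<open>Empty contexts are admissible here because normal forms are nonempty.\<close>
  then have "\<pi> (nf u) \<otimes>\<^bsub>U\<^esub> \<pi> (nf v) = \<pi> (nf w)"
    using nf_carrier[OF mem(1)] nf_carrier[OF mem(2)]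
    unfolding multiplies_def by (elim conjE ballE[of _ _ "[]"]) auto
  then show "x \<in> mult_table U \<pi> c d R"
    using mem unfolding x mult_table_def by blast
qed

text \<open>Alternating words that do not begin in \<open>S\<close> form the star of the pairs
  \<open>?R2 ?R1\<close>, followed by at most one word of \<open>?R2\<close>; this is
  \<open>P\<close>. Those that begin in \<open>S\<close> form \<open>?R1 P\<close>.\<close>

lemma regular_R:
  assumes R1: "regular_language (n ` Inl ` carrier S)"
    and R2: "regular_language (n ` Inr ` carrier T)"
  shows "regular_language R"
proof -
  let ?R1 = "n ` Inl ` carrier S" and ?R2 = "n ` Inr ` carrier T"
  let ?alt = "successively (\<lambda>a b :: 'a + 'b. isl a \<noteq> isl b)"
  let ?W = "{w \<in> lists X. ?alt w \<and> (w \<noteq> [] \<longrightarrow> \<not> isl (hd w))}"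
  define P where "P = lang_concat (lang_star (lang_concat ?R2 ?R1)) (insert [] ?R2)"
  have P_cons: "u @ v @ w \<in> P" if uvw: "u \<in> ?R2" "v \<in> ?R1" "w \<in> P" for u v w
  proof -
    obtain w1 w2 where w: "w = w1 @ w2" "w1 \<in> lang_star (lang_concat ?R2 ?R1)" "w2 \<in> insert [] ?R2"
      using uvw(3) by (auto simp: P_def lang_concat_def)
    have "u @ v \<in> lang_concat ?R2 ?R1"
      using that unfolding lang_concat_def by blast
    then have "(u @ v) @ w1 \<in> lang_star (lang_concat ?R2 ?R1)"
      by (intro lang_star_append lang_starI w(2))
    moreover have "u @ v @ w = ((u @ v) @ w1) @ w2" using w by simp
    ultimately show ?thesis using w(3) unfolding P_def lang_concat_def by blast
  qed
  have P_base: "insert [] ?R2 \<subseteq> P"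
    using Nil_in_lang_star unfolding P_def lang_concat_def by force
  have "nf ` ?W \<subseteq> P"
  proof (rule image_subsetI)
    fix w assume "w \<in> ?W"
    then show "nf w \<in> P"
    \<comment> \<open>Letters are taken two at a time, one of \<open>T\<close> and one of
      \<open>S\<close>, to match a factor of the star.\<close>
    proof (induction w rule: induct_list012)
      case 1
      then show ?case using P_base by auto
    next
      case (2 a)
      then have "n a \<in> ?R2" by (cases a) auto
      then show ?case using P_base by auto
    next
      case (3 a b w)
      then have "n a \<in> ?R2" "n b \<in> ?R1"
        by (cases a; cases b; auto)+
      moreover have "nf w \<in> P"
        using 3 by (cases w) (auto simp: successively_Cons)
      ultimately show ?case using P_cons by simp
    qed
  qed
  moreover have "P \<subseteq> nf ` ?W"
  proof -
    have "concat ws @ v \<in> nf ` ?W"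
      if ws: "ws \<in> lists (lang_concat ?R2 ?R1)" and v: "v \<in> insert [] ?R2" for ws v
      using ws
    proof (induction ws)
      case Nil
      show ?case
      proof (cases "v = []")
        case True
        then show ?thesis by (intro image_eqI[of _ _ "[]"]) auto
      next
        case False
        then obtain y where "y \<in> carrier T" "v = n (Inr y)" using v by auto
        then show ?thesis by (intro image_eqI[of _ _ "[Inr y]"]) auto
      qed
    next
      case (Cons u ws)
      then obtain w where w: "w \<in> ?W" "concat ws @ v = nf w" by auto
      obtain x y where "x \<in> carrier S" "y \<in> carrier T" "u = n (Inr y) @ n (Inl x)"
        using Cons.hyps by (auto simp: lang_concat_def)
      then show ?case
        using w by (intro image_eqI[of _ _ "Inr y # Inl x # w"]) (auto simp: successively_Cons)
    qed
    then show ?thesis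
      unfolding P_def lang_star_def by (intro subsetI, elim lang_concatE imageE) (simp only:)
  qed
  ultimately have P: "P = nf ` ?W" by blast
  have "regular_language P"
    unfolding P_def insert_is_Un[of _ ?R2]
    by (intro regular_language_concat regular_language_star regular_language_Un R1 R2
        regular_language_finite) simp
  have alt: "{w \<in> lists X. ?alt w} = ?W \<union> {Inl x # w | x w. x \<in> carrier S \<and> w \<in> ?W}"
    (is "?l = ?r")
  proof (intro subset_antisym subsetI)
    fix w assume "w \<in> ?l"
    then show "w \<in> ?r"
      by (cases w; cases "hd w") (auto simp: successively_Cons)
  next
    fix w assume "w \<in> ?r"
    then show "w \<in> ?l" by (auto simp: successively_Cons)
  qed
  have nf_alt: "nf ` {w \<in> lists X. ?alt w} = P \<union> lang_concat ?R1 P"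
  proof -
    have "nf ` {Inl x # w | x w. x \<in> carrier S \<and> w \<in> V} = lang_concat ?R1 (nf ` V)" for V
    proof (intro subset_antisym subsetI)
      fix t assume "t \<in> nf ` {Inl x # w | x w. x \<in> carrier S \<and> w \<in> V}"
      then obtain x w where "x \<in> carrier S" "w \<in> V" "t = n (Inl x) @ nf w" by auto
      then show "t \<in> lang_concat ?R1 (nf ` V)" by (auto intro: lang_concatI)
    next
      fix t assume "t \<in> lang_concat ?R1 (nf ` V)"
      then obtain x w where "x \<in> carrier S" "w \<in> V" "t = nf (Inl x # w)"
        by (auto elim: lang_concatE)
      then show "t \<in> nf ` {Inl x # w | x w. x \<in> carrier S \<and> w \<in> V}" by blast
    qed
    then show ?thesis unfolding alt image_Un P by (simp only:)
  qed
  have "regular_language (P \<union> lang_concat ?R1 P)"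
    by (intro regular_language_Un regular_language_concat R1 \<open>regular_language P\<close>)
  \<comment> \<open>Letters have nonempty normal forms, so \<open>[]\<close> stems from the empty
    alternating word alone.\<close>
  moreover have "R = (P \<union> lang_concat ?R1 P) - {[]}"
    unfolding nf_alt[symmetric]
  proof (intro subset_antisym subsetI)
    fix t assume "t \<in> R"
    then show "t \<in> nf ` {w \<in> lists X. ?alt w} - {[]}"
      using nf_carrier(2) by (auto simp: carrier_U)
  next
    fix t assume "t \<in> nf ` {w \<in> lists X. ?alt w} - {[]}"
    then obtain w where w: "w \<in> lists X" "?alt w" "t = nf w" "nf w \<noteq> []" by blast
    then have "w \<noteq> []" by auto
    then show "t \<in> R" using w by (simp add: carrier_U)
  qed
  ultimately show ?thesis
    by (simp add: regular_language_Diff_finite)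
qed

theorem tabled_free_product:
  assumes C: "super_AFL C"
    and R1: "regular_language (n ` Inl ` carrier S)"
    and R2: "regular_language (n ` Inr ` carrier T)"
    and table: "letter_table \<in> C"
  shows "tabled C U"
proof -
  have AFL: "full_AFL C" and ancestor: "monadic_ancestor_property C"
    using C by (auto simp: super_AFL_def)
  have R: "regular_language R"
    using R1 R2 by (rule regular_R)
  have "{[s]} \<in> C"
    using full_AFL_regular[OF AFL] table regular_language_finite[of "{[s]}"] by blast
  moreover have "{[s]} \<subseteq> lists B" "finite B"
    using finite_A by auto
  ultimately have "ancestors B rules {[s]} \<in> C"
    using ancestor class_monadic_rules[OF AFL table] unfolding monadic_ancestor_property_def by blast
  moreover have "regular_language
      (lang_concat R (lang_concat {[c]} (lang_concat R (lang_concat {[d]} (rev ` R)))))"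
    by (intro regular_language_concat regular_language_rev R regular_language_finite) auto
  ultimately have "mult_table U \<pi> c d R \<in> C"
    using AFL unfolding mult_table_eq_ancestors full_AFL_def by blast
  moreover have "\<pi> \<in> epi (free_semigroup A) U"
  proof -
    have "w \<in> \<pi> ` carrier (free_semigroup A)" if "w \<in> carrier U" for w
      using \<pi>_nf[OF that] nf_carrier[OF that]
      by (intro image_eqI[of _ _ "nf w"]) (auto simp: free_semigroup_def)
    then show ?thesis
      using \<pi>_hom by (auto simp: epi_def hom_in_carrier)
  qed
  moreover have "normal_forms U A \<pi> R"
    unfolding normal_forms_def using R nf_carrier \<pi>_nf
    by (auto simp: free_semigroup_def)
  ultimately show ?thesis
    unfolding tabled_def using finite_A fresh by blast
qed

end

section \<open>Normal forms and tables of the factors\<close>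

lemma word_hom_letters: "(\<And>a. a \<in> set w \<Longrightarrow> h a = [g a]) \<Longrightarrow> word_hom h w = map g w"
  by (induction w) (auto simp: word_hom_def)

text \<open>A letter-to-letter homomorphism renames the generators and turns the factor's own
  markers into the prescribed ones. The two do not interfere, as the markers lie outside
  \<open>A\<close>.\<close>

lemma renamed_mult_table:
  assumes C: "full_AFL C" and table: "mult_table S \<pi> c d R \<in> C"
    and R: "R \<subseteq> lists A" and fresh: "c \<notin> A" "d \<notin> A" "c \<noteq> d"
  shows "{map h u @ [c'] @ map h v @ [d'] @ rev (map h w) | u v w.
      u \<in> R \<and> v \<in> R \<and> w \<in> R \<and> \<pi> u \<otimes>\<^bsub>S\<^esub> \<pi> v = \<pi> w} \<in> C"
    (is "?T \<in> C")
proof -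
  define g where "g a = (if a = c then c' else if a = d then d' else h a)" for a
  have "word_hom (\<lambda>a. [g a]) (u @ [c] @ v @ [d] @ rev w) =
      map h u @ [c'] @ map h v @ [d'] @ rev (map h w)"
    if "u \<in> R" "v \<in> R" "w \<in> R" for u v w
  proof -
    have "map g x = map h x" if "x \<in> R" for x
      using R fresh that by (auto simp: g_def)
    then show ?thesis
      using that fresh by (simp add: word_hom_letters[of _ _ g] rev_map[symmetric]) (simp add: g_def)
  qed
  then have "word_hom (\<lambda>a. [g a]) ` mult_table S \<pi> c d R = ?T"
    unfolding mult_table_def by (auto simp: image_iff) metis+
  then show ?thesis
    using C table unfolding full_AFL_def by metis
qed

definition normal_form :: "(word \<Rightarrow> 'a) \<Rightarrow> lang \<Rightarrow> 'a \<Rightarrow> word" where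
  "normal_form \<pi> R x = (THE w. w \<in> R \<and> \<pi> w = x)"

lemma normal_form:
  assumes "normal_forms S A \<pi> R" "x \<in> carrier S"
  shows "normal_form \<pi> R x \<in> R" "\<pi> (normal_form \<pi> R x) = x"
proof -
  have "\<exists>!w. w \<in> R \<and> \<pi> w = x"
    using assms by (simp add: normal_forms_def)
  from theI'[OF this] show "normal_form \<pi> R x \<in> R" "\<pi> (normal_form \<pi> R x) = x"
    by (simp_all add: normal_form_def)
qed

lemma normal_form_eq:
  assumes "normal_forms S A \<pi> R" and \<pi>: "\<pi> \<in> epi (free_semigroup A) S" and "w \<in> R"
  shows "\<pi> w \<in> carrier S" "normal_form \<pi> R (\<pi> w) = w"
proof -
  have "w \<in> carrier (free_semigroup A)"
    using assms by (auto simp: normal_forms_def)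
  then show *: "\<pi> w \<in> carrier S"
    using \<pi> by (auto simp: epi_def hom_in_carrier)
  have "\<exists>!v. v \<in> R \<and> \<pi> v = \<pi> w"
    using assms(1) * by (simp add: normal_forms_def)
  then show "normal_form \<pi> R (\<pi> w) = w"
    using normal_form[OF assms(1) *] assms(3) by blast
qed

lemma normal_form_image:
  assumes "normal_forms S A \<pi> R" "\<pi> \<in> epi (free_semigroup A) S"
  shows "normal_form \<pi> R ` carrier S = R"
  using normal_form[OF assms(1)] normal_form_eq[OF assms] by (force simp: image_iff)

text \<open>Passes from words to elements as parameters, the product forcing \<open>w\<close>. The
  function \<open>f\<close> abstracts the shape of an entry, so that each factor can have its own
  renaming.\<close>

lemma normal_form_mult_table:
  assumes "normal_forms S A \<pi> R" "\<pi> \<in> epi (free_semigroup A) S" "alg_semigroup S"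
  shows "{f u v w | u v w. u \<in> R \<and> v \<in> R \<and> w \<in> R \<and> \<pi> u \<otimes>\<^bsub>S\<^esub> \<pi> v = \<pi> w} =
    {f (normal_form \<pi> R x) (normal_form \<pi> R y) (normal_form \<pi> R (x \<otimes>\<^bsub>S\<^esub> y)) | x y.
      x \<in> carrier S \<and> y \<in> carrier S}" (is "?L = ?M")
proof (intro subset_antisym subsetI)
  fix t assume "t \<in> ?L"
  then obtain u v w where *: "t = f u v w" "u \<in> R" "v \<in> R" "w \<in> R" "\<pi> u \<otimes>\<^bsub>S\<^esub> \<pi> v = \<pi> w"
    by blast
  then have "t = f (normal_form \<pi> R (\<pi> u)) (normal_form \<pi> R (\<pi> v)) (normal_form \<pi> R (\<pi> u \<otimes>\<^bsub>S\<^esub> \<pi> v))"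
    using normal_form_eq[OF assms(1,2)] by simp
  then show "t \<in> ?M"
    using * normal_form_eq[OF assms(1,2)] by blast
next
  fix t assume "t \<in> ?M"
  then obtain x y where t: "t = f (normal_form \<pi> R x) (normal_form \<pi> R y) (normal_form \<pi> R (x \<otimes>\<^bsub>S\<^esub> y))"
    and xy: "x \<in> carrier S" "y \<in> carrier S"
    by blast
  have "x \<otimes>\<^bsub>S\<^esub> y \<in> carrier S"
    using xy assms(3) by (simp add: alg_semigroup.mult_closed)
  note nf = normal_form[OF assms(1) xy(1)] normal_form[OF assms(1) xy(2)] normal_form[OF assms(1) this]
  have "\<pi> (normal_form \<pi> R x) \<otimes>\<^bsub>S\<^esub> \<pi> (normal_form \<pi> R y) = \<pi> (normal_form \<pi> R (x \<otimes>\<^bsub>S\<^esub> y))"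
    by (simp add: nf)
  then show "t \<in> ?L"
    using nf t by blast
qed

section \<open>From the two given tables to the encoding\<close>

theorem theorem1:
  fixes C :: "lang set"
    and S1 :: "('a, 'm) monoid_scheme"
    and S2 :: "('b, 'n) monoid_scheme"
  assumes "reversal_closed C" and "super_AFL C"
    and "alg_semigroup S1" and "alg_semigroup S2"
    and "tabled C S1" and "tabled C S2"
  shows "tabled C (free_product S1 S2)"
proof -
  let ?U = "free_product S1 S2"
  have AFL: "full_AFL C"
    using assms(2) by (simp add: super_AFL_def)
  obtain A1 \<pi>1 R1 c1 d1 where 1: "finite A1" "\<pi>1 \<in> epi (free_semigroup A1) S1"
      "normal_forms S1 A1 \<pi>1 R1" "c1 \<notin> A1" "d1 \<notin> A1" "c1 \<noteq> d1" "mult_table S1 \<pi>1 c1 d1 R1 \<in> C"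
    using assms(5) unfolding tabled_def by blast
  obtain A2 \<pi>2 R2 c2 d2 where 2: "finite A2" "\<pi>2 \<in> epi (free_semigroup A2) S2"
      "normal_forms S2 A2 \<pi>2 R2" "c2 \<notin> A2" "d2 \<notin> A2" "c2 \<noteq> d2" "mult_table S2 \<pi>2 c2 d2 R2 \<in> C"
    using assms(6) unfolding tabled_def by blast
  have R1: "R1 \<subseteq> lists A1" "[] \<notin> R1" "regular_language R1"
    and R2: "R2 \<subseteq> lists A2" "[] \<notin> R2" "regular_language R2"
    using 1(3) 2(3) by (auto simp: normal_forms_def free_semigroup_def)
  \<comment> \<open>The odd numbers from 3 and the even ones from 4 keep the generators apart and
    leave 0, 1, 2 for \<open>c\<close>, \<open>d\<close>, \<open>s\<close>.\<close>
  define h1 h2 :: "nat \<Rightarrow> nat" where "h1 a = 2 * a + 3" and "h2 a = 2 * a + 4" for a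
  define A where "A = h1 ` A1 \<union> h2 ` A2"
  \<comment> \<open>Undoes the renaming: parity tells the factor, and the recovered letter is
    evaluated there as a one-letter word.\<close>
  define g where "g m = (if odd m then [Inl (\<pi>1 [(m - 3) div 2])] else [Inr (\<pi>2 [(m - 4) div 2])])"
    for m :: nat
  have g: "g (h1 a) = [Inl (\<pi>1 [a])]" "g (h2 a) = [Inr (\<pi>2 [a])]" for a
    by (auto simp: g_def h1_def h2_def)
  define \<pi> where "\<pi> = word_product ?U g"
  define n where "n = case_sum (\<lambda>x. map h1 (normal_form \<pi>1 R1 x))
    (\<lambda>y. map h2 (normal_form \<pi>2 R2 y))"
  have hom1: "(\<lambda>w. [Inl (\<pi>1 w)]) \<in> hom (free_semigroup A1) ?U"
    using hom_compose[OF _ free_product_inclusions(1)[OF assms(3,4)], of \<pi>1 "free_semigroup A1"] 1(2)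
    by (simp add: epi_def comp_def)
  have hom2: "(\<lambda>w. [Inr (\<pi>2 w)]) \<in> hom (free_semigroup A2) ?U"
    using hom_compose[OF _ free_product_inclusions(2)[OF assms(3,4)], of \<pi>2 "free_semigroup A2"] 2(2)
    by (simp add: epi_def comp_def)
  have "g ` A \<subseteq> carrier ?U"
  proof -
    have "g (h1 a) \<in> carrier ?U" if "a \<in> A1" for a
      using hom_in_carrier[OF hom1, of "[a]"] that by (simp add: g free_semigroup_def)
    moreover have "g (h2 a) \<in> carrier ?U" if "a \<in> A2" for a
      using hom_in_carrier[OF hom2, of "[a]"] that by (simp add: g free_semigroup_def)
    ultimately show ?thesis by (auto simp: A_def)
  qed
  then have \<pi>: "\<pi> \<in> hom (free_semigroup A) ?U"
    unfolding \<pi>_def by (intro word_product_hom free_product_semigroup assms)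
  \<comment> \<open>Both sides are homomorphisms in \<open>w\<close> that agree on single
    letters.\<close>
  have \<pi>1: "\<pi> (map h1 w) = [Inl (\<pi>1 w)]" if "w \<in> R1" for w
    by (rule free_semigroup_hom_ext[OF free_semigroup_hom_map[OF \<pi>] hom1])
      (use that R1 in \<open>auto simp: A_def \<pi>_def g\<close>)
  have \<pi>2: "\<pi> (map h2 w) = [Inr (\<pi>2 w)]" if "w \<in> R2" for w
    by (rule free_semigroup_hom_ext[OF free_semigroup_hom_map[OF \<pi>] hom2])
      (use that R2 in \<open>auto simp: A_def \<pi>_def g\<close>)
  note nf1 = normal_form[OF 1(3)] and nf2 = normal_form[OF 2(3)]
  interpret product_encoding S1 S2 A \<pi> n 0 1 2
  proof
    show "finite A" using 1(1) 2(1) by (simp add: A_def)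
    show "0 \<notin> A" "1 \<notin> A" "2 \<notin> A"
      by (auto simp: A_def h1_def h2_def)
    fix a assume a: "a \<in> carrier S1 <+> carrier S2"
    show "n a \<in> lists A"
    proof (cases a)
      case (Inl x)
      then have "normal_form \<pi>1 R1 x \<in> lists A1" using a nf1(1) R1 by auto
      then show ?thesis by (auto simp: n_def Inl A_def)
    next
      case (Inr y)
      then have "normal_form \<pi>2 R2 y \<in> lists A2" using a nf2(1) R2 by auto
      then show ?thesis by (auto simp: n_def Inr A_def)
    qed
    show "n a \<noteq> []"
      using a nf1(1) nf2(1) R1(2) R2(2) by (auto simp: n_def) metis+
    show "\<pi> (n a) = [a]"
      using a nf1 nf2 by (auto simp: n_def \<pi>1 \<pi>2)
  qed (use assms \<pi> in \<open>auto simp: alg_semigroup.mult_closed alg_semigroup.mult_assoc\<close>)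
  let ?f = "\<lambda>h u v w. map h u @ [0] @ map h v @ [1] @ rev (map h w)"
  have "letter_table =
      {?f h1 u v w | u v w. u \<in> R1 \<and> v \<in> R1 \<and> w \<in> R1 \<and> \<pi>1 u \<otimes>\<^bsub>S1\<^esub> \<pi>1 v = \<pi>1 w} \<union>
      {?f h2 u v w | u v w. u \<in> R2 \<and> v \<in> R2 \<and> w \<in> R2 \<and> \<pi>2 u \<otimes>\<^bsub>S2\<^esub> \<pi>2 v = \<pi>2 w}"
    (is "_ = ?T1 \<union> ?T2")
  proof -
    have "?T1 = {n (Inl x) @ [0] @ n (Inl y) @ [1] @ rev (n (Inl (x \<otimes>\<^bsub>S1\<^esub> y))) | x y.
        x \<in> carrier S1 \<and> y \<in> carrier S1}"
      (is "_ = ?M1")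
      unfolding normal_form_mult_table[OF 1(3,2) assms(3)] by (simp add: n_def)
    moreover have "?T2 = {n (Inr x) @ [0] @ n (Inr y) @ [1] @ rev (n (Inr (x \<otimes>\<^bsub>S2\<^esub> y))) | x y.
        x \<in> carrier S2 \<and> y \<in> carrier S2}"
      (is "_ = ?M2")
      unfolding normal_form_mult_table[OF 2(3,2) assms(4)] by (simp add: n_def)
    \<comment> \<open>Letters of different factors never merge, so each entry stems from one
      factor.\<close>
    moreover have "letter_table = ?M1 \<union> ?M2"
    proof (intro subset_antisym subsetI)
      fix t assume "t \<in> letter_table"
      then obtain a b e where t: "t = n a @ [0] @ n b @ [1] @ rev (n e)"
        and "a \<in> carrier S1 <+> carrier S2" "b \<in> carrier S1 <+> carrier S2"
        and "join S1 S2 a b = [e]"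
        unfolding letter_table_def by blast
      then show "t \<in> ?M1 \<union> ?M2"
        by (cases a; cases b) auto
    next
      fix t assume "t \<in> ?M1 \<union> ?M2"
      then show "t \<in> letter_table"
        by (elim UnE CollectE exE conjE) (simp_all only:, (rule letter_tableI; auto)+)
    qed
    ultimately show ?thesis by (simp only:)
  qed
  moreover have "?T1 \<in> C"
    using renamed_mult_table[OF AFL 1(7) R1(1) 1(4-6)] .
  moreover have "?T2 \<in> C"
    using renamed_mult_table[OF AFL 2(7) R2(1) 2(4-6)] .
  ultimately have "letter_table \<in> C"
    using full_AFL_Un[OF AFL] by simp
  moreover have "n ` Inl ` carrier S1 = map h1 ` normal_form \<pi>1 R1 ` carrier S1"
    "n ` Inr ` carrier S2 = map h2 ` normal_form \<pi>2 R2 ` carrier S2"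
    by (simp_all add: n_def image_image)
  then have "n ` Inl ` carrier S1 = map h1 ` R1" "n ` Inr ` carrier S2 = map h2 ` R2"
    by (simp_all only: normal_form_image[OF 1(3,2)] normal_form_image[OF 2(3,2)])
  moreover have "inj h1" "inj h2"
    by (auto simp: inj_def h1_def h2_def)
  ultimately show ?thesis
    using assms(2) R1(3) R2(3) by (intro tabled_free_product) (simp_all add: regular_language_map)
qed

end
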